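(* For any reward sequence (no distributional assumption on the success vectors $\mathbf r_t\in\{0,1\}^n$ and cost vectors $\mathbf c_t\in[0,C_{\max}]^n$, $t=1,\dots,T$) and any interval $[\ell,\ell+L-1]\subseteq[n-1,T]$ (with $\ell$ and $L\ge 1$ integers), the Primal-Dual ACI algorithm with parameters $\Lambda>0$ and $\eta>0$ satisfies $$\left|\frac1L\sum_{t=\ell}^{\ell+L-1}Y_t-\phi\right|\le\frac{\Lambda+2\eta}{\eta L}=O\!\left(\frac{\Lambda}{\eta L}\right).$$
   Context: Bandit model. There are $n\ge 2$ arms, two of which are distinguished: $i_{\max}$, for which $r_{i_{\max},t}=1$ and $c_{i_{\max},t}=C_{\max}$ always, and $i_{\min}$, for which $r_{i_{\min},t}=0$ and $c_{i_{\min},t}=0$ always. At each time $t\in\{1,\dots,T\}$ a success vector $\mathbf r_t\in\{0,1\}^n$ and a cost vector $\mathbf c_t\in[0,C_{\max}]^n$ are realized; the learner plays one arm $i_t$ and observes only $r_{i_t,t}$ and $c_{i_t,t}$. $\phi\in(0,1)$ is a target success rate. Standing assumptions of the model: $C_{\max}\ge1$, $n=o(T)$, and $\phi$ is bounded away from both $0$ and $1$ by a constant. Primal-Dual ACI algorithm with parameters $\Lambda>0$, $\eta>0$. Initialization: during times $t=1,\dots,n-2$ play each arm $i\notin\{i_{\min},i_{\max}\}$ exactly once; the dual variable is not updated during this phase. After initialization the dual variable is $\lambda_{n-1}=0$. For each time $t=n-1,n,\dots,T$: (1) For each arm $i\notin\{i_{\min},i_{\max}\}$ let $t_i$ be the number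 of times it has been played before time $t$, let $\mu_{i,t_i}$ and $\chi_{i,t_i}$ be the empirical means of its observed rewards and costs, let $\Delta_{i,t_i}=\sqrt{2\ln(nT)/t_i}$, and set $\bar R_{i,t-1}=\mu_{i,t_i}+\Delta_{i,t_i}$, $\bar C_{i,t-1}=\chi_{i,t_i}-C_{\max}\Delta_{i,t_i}$. For the boundary arms $t_i=\infty$, i.e. the exact values are used: $\bar R_{i_{\max},t-1}=1$, $\bar C_{i_{\max},t-1}=C_{\max}$, $\bar R_{i_{\min},t-1}=\bar C_{i_{\min},t-1}=0$. (2) If $\lambda_t\ge\Lambda$ play $i_t=i_{\max}$; else if $\lambda_t\le 0$ play $i_t=i_{\min}$; else play $i_t\in\arg\min_i\left(\bar C_{i,t-1}-\lambda_t\bar R_{i,t-1}\right)$ (minimum over all $n$ arms). (3) Observe the success indicator $Y_t=r_{i_t,t}$ and set $\lambda_{t+1}=\lambda_t+\eta(\phi-Y_t)$.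
   Formalization: The closing O(Λ/(ηL)) is proved for parameters with η ≤ KΛ, for every constant K>0 (hidden constant depending on K); for unrestricted Λ, η > 0 it fails, as the ratio of the two sides is 1+2η/Λ. *)

theory Defs
  imports Complex_Main "HOL-Library.Landau_Symbols"
begin

text \<open>Arms are the numbers \<open>1, \<dots>, n\<close>; \<open>r t i\<close> and \<open>c t i\<close> are the success
  indicator and the cost of arm \<open>i\<close> at time \<open>t\<close>. The sequences are arbitrary: nothing
  is assumed about how they are generated.\<close>

locale bandit_model =
  fixes n T :: nat and Cmax \<phi> :: real and imin imax :: nat
    and r c :: "nat \<Rightarrow> nat \<Rightarrow> real"
  assumes n_ge_2: "2 \<le> n"
    and imin_arm: "imin \<in> {1..n}"
    and imax_arm: "imax \<in> {1..n}"
    and imin_neq_imax: "imin \<noteq> imax"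
    and Cmax_ge_1: "1 \<le> Cmax"
    and phi_pos: "0 < \<phi>"
    and phi_less_1: "\<phi> < 1"
    and reward_range: "\<lbrakk>t \<in> {1..T}; i \<in> {1..n}\<rbrakk> \<Longrightarrow> r t i \<in> {0, 1}"
    and cost_range: "\<lbrakk>t \<in> {1..T}; i \<in> {1..n}\<rbrakk> \<Longrightarrow> c t i \<in> {0..Cmax}"
    and reward_imax: "t \<in> {1..T} \<Longrightarrow> r t imax = 1"
    and cost_imax: "t \<in> {1..T} \<Longrightarrow> c t imax = Cmax"
    and reward_imin: "t \<in> {1..T} \<Longrightarrow> r t imin = 0"
    and cost_imin: "t \<in> {1..T} \<Longrightarrow> c t imin = 0"

definition plays_before :: "(nat \<Rightarrow> nat) \<Rightarrow> nat \<Rightarrow> nat \<Rightarrow> nat set" where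
  "plays_before play i t = {s \<in> {1..<t}. play s = i}"

definition emp_mean :: "(nat \<Rightarrow> nat \<Rightarrow> real) \<Rightarrow> (nat \<Rightarrow> nat) \<Rightarrow> nat \<Rightarrow> nat \<Rightarrow> real" where
  "emp_mean x play i t =
     (\<Sum>s\<in>plays_before play i t. x s i) / real (card (plays_before play i t))"

definition conf_radius :: "nat \<Rightarrow> nat \<Rightarrow> (nat \<Rightarrow> nat) \<Rightarrow> nat \<Rightarrow> nat \<Rightarrow> real" where
  "conf_radius n T play i t =
     sqrt (2 * ln (real n * real T) / real (card (plays_before play i t)))"

text \<open>The optimistic estimates used at time \<open>t\<close>, built from the observations made strictly
  before time \<open>t\<close> (so \<open>Rbar \<dots> i t\<close> is \<open>R\<close>-bar with index \<open>i, t - 1\<close>).\<close>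

definition Rbar ::
  "nat \<Rightarrow> nat \<Rightarrow> nat \<Rightarrow> nat \<Rightarrow> (nat \<Rightarrow> nat \<Rightarrow> real) \<Rightarrow> (nat \<Rightarrow> nat) \<Rightarrow> nat \<Rightarrow> nat \<Rightarrow> real"
where
  "Rbar n T imin imax r play i t =
     (if i = imax then 1
      else if i = imin then 0
      else emp_mean r play i t + conf_radius n T play i t)"

definition Cbar ::
  "nat \<Rightarrow> nat \<Rightarrow> real \<Rightarrow> nat \<Rightarrow> nat \<Rightarrow> (nat \<Rightarrow> nat \<Rightarrow> real) \<Rightarrow> (nat \<Rightarrow> nat) \<Rightarrow> nat \<Rightarrow> nat \<Rightarrow> real"
where
  "Cbar n T Cmax imin imax c play i t =
     (if i = imax then Cmax
      else if i = imin then 0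
      else emp_mean c play i t - Cmax * conf_radius n T play i t)"

definition success :: "(nat \<Rightarrow> nat \<Rightarrow> real) \<Rightarrow> (nat \<Rightarrow> nat) \<Rightarrow> nat \<Rightarrow> real" where
  "success r play t = r t (play t)"

text \<open>\<open>play\<close> and \<open>lam\<close> are the arms played and the dual variables in a run of the Primal-Dual
  ACI algorithm. The order of the initial plays and the tie-breaking in the minimisation are
  left open, so every admissible run is covered.\<close>

locale primal_dual_aci = bandit_model n T Cmax \<phi> imin imax r c
  for n T :: nat and Cmax \<phi> :: real and imin imax :: nat
    and r c :: "nat \<Rightarrow> nat \<Rightarrow> real" +
  fixes \<Lambda> \<eta> :: real and play :: "nat \<Rightarrow> nat" and lam :: "nat \<Rightarrow> real"
  assumes Lambda_pos: "0 < \<Lambda>"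
    and eta_pos: "0 < \<eta>"
    and init_plays: "bij_betw play {1..n - 2} ({1..n} - {imin, imax})"
    and init_dual: "lam (n - 1) = 0"
    and play_high: "\<lbrakk>t \<in> {n - 1..T}; lam t \<ge> \<Lambda>\<rbrakk> \<Longrightarrow> play t = imax"
    and play_low: "\<lbrakk>t \<in> {n - 1..T}; lam t < \<Lambda>; lam t \<le> 0\<rbrakk> \<Longrightarrow> play t = imin"
    and play_mid: "\<lbrakk>t \<in> {n - 1..T}; lam t < \<Lambda>; 0 < lam t\<rbrakk> \<Longrightarrow>
      is_arg_min (\<lambda>i. Cbar n T Cmax imin imax c play i t - lam t * Rbar n T imin imax r play i t)
        (\<lambda>i. i \<in> {1..n}) (play t)"
    and dual_update: "t \<in> {n - 1..T} \<Longrightarrow>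
      lam (Suc t) = lam t + \<eta> * (\<phi> - success r play t)"

end

(* The dual variable moves by at most eta per step and is pushed back as soon as it leaves
   [0, Lambda], so it stays in [-eta, Lambda + eta]. The dual updates telescope:
   eta * (phi * L - sum of Y_t) is the net change of the dual variable over the interval,
   which is therefore at most Lambda + 2 * eta in absolute value. *)

theory Submission
  imports Defs
begin

context primal_dual_aci
begin

lemma play_arm:
  assumes "t \<in> {n - 1..T}"
  shows "play t \<in> {1..n}"
proof -
  consider "lam t \<ge> \<Lambda>" | "lam t < \<Lambda>" "lam t \<le> 0" | "lam t < \<Lambda>" "0 < lam t"
    by linarith
  then show ?thesis
  proof cases
    case 1
    then show ?thesis using play_high assms imax_arm by metis
  next
    case 2
    then show ?thesis using play_low assms imin_arm by metis
  next
    case 3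
    \<comment> \<open>\<open>is_arg_min\<close> includes feasibility, which places the minimiser in
      \<open>{1..n}\<close>.\<close>
    then show ?thesis using play_mid assms unfolding is_arg_min_def by blast
  qed
qed

lemma success_range:
  assumes "t \<in> {n - 1..T}"
  shows "success r play t \<in> {0, 1}"
proof -
  have "t \<in> {1..T}" using assms n_ge_2 by auto
  then show ?thesis unfolding success_def using reward_range play_arm[OF assms] by blast
qed

text \<open>The slack of \<eta> on each side is the overshoot of one step started between 0 and
  \<Lambda>. The range of \<open>t\<close> reaches \<open>Suc T\<close> because an interval ending
  at time \<open>T\<close> telescopes to \<open>lam (Suc T)\<close>.\<close>

lemma dual_in_range:
  assumes "n - 1 \<le> t" and "t \<le> Suc T"
  shows "lam t \<in> {-\<eta>..\<Lambda> + \<eta>}"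
  using assms
proof (induction t rule: dec_induct)
  case base
  then show ?case using init_dual Lambda_pos eta_pos by simp
next
  case (step t)
  then have t: "t \<in> {n - 1..T}" and t1: "t \<in> {1..T}"
    using n_ge_2 by auto
  have IH: "-\<eta> \<le> lam t" "lam t \<le> \<Lambda> + \<eta>" using step by auto
  \<comment> \<open>A failure raises the dual variable by \<eta> * \<phi>, a success lowers it by
    \<eta> * (1 - \<phi>); both amounts lie strictly between 0 and \<eta>.\<close>
  have phi_step: "0 < \<eta> * \<phi>" "\<eta> * \<phi> < \<eta>"
    using eta_pos phi_pos phi_less_1 by simp_all
  have upd: "lam (Suc t) = lam t + \<eta> * \<phi> - \<eta> * success r play t"
    using dual_update[OF t] by (simp add: right_diff_distrib)
  consider "lam t \<ge> \<Lambda>" | "lam t < \<Lambda>" "lam t \<le> 0" | "lam t < \<Lambda>" "0 < lam t"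
    by linarith
  then show ?case
  proof cases
    case 1
    then have "success r play t = 1"
      using play_high[OF t] reward_imax[OF t1] by (simp add: success_def)
    \<comment> \<open>The step goes down, so the upper bound is inherited; starting from at least
      \<Lambda> > 0, it cannot fall below -\<eta>. The next case is the mirror image.\<close>
    then show ?thesis using upd 1 IH phi_step Lambda_pos by simp
  next
    case 2
    then have "success r play t = 0"
      using play_low[OF t] reward_imin[OF t1] by (simp add: success_def)
    then show ?thesis using upd 2 IH phi_step Lambda_pos by simp
  next
    case 3
    \<comment> \<open>Here the arm depends on the estimates, so the success may be 0 or 1; either
      way a step shorter than \<eta> starts strictly between 0 and \<Lambda>.\<close>
    then show ?thesis using upd success_range[OF t] phi_step by auto
  qed
qed

lemma dual_telescope:
  assumes "n - 1 \<le> l" and "l + k \<le> Suc T"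
  shows "lam (l + k) - lam l = \<eta> * (\<phi> * real k - (\<Sum>t = l..<l + k. success r play t))"
  using assms(2)
proof (induction k)
  case 0
  then show ?case by simp
next
  case (Suc k)
  then have "l + k \<in> {n - 1..T}" using assms(1) by auto
  with Suc show ?case using dual_update[of "l + k"] by (simp add: algebra_simps)
qed

lemma average_success_deviation:
  assumes "n - 1 \<le> l" and "l + L \<le> Suc T" and "0 < L"
  shows "\<bar>(1 / real L) * (\<Sum>t = l..<l + L. success r play t) - \<phi>\<bar> \<le> (\<Lambda> + 2 * \<eta>) / (\<eta> * real L)"
proof -
  let ?S = "\<Sum>t = l..<l + L. success r play t"
  have "\<bar>lam (l + L) - lam l\<bar> \<le> \<Lambda> + 2 * \<eta>"
    using dual_in_range[of l] dual_in_range[of "l + L"] assms by auto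
  \<comment> \<open>The telescoped identity divided by -\<eta> * L: the deviation is a scaled
    difference of two points in an interval of length \<Lambda> + 2 * \<eta>.\<close>
  moreover have "(1 / real L) * ?S - \<phi> = - (lam (l + L) - lam l) / (\<eta> * real L)"
    unfolding dual_telescope[OF assms(1,2)] using eta_pos assms(3) by (simp add: field_simps)
  ultimately show ?thesis
    using eta_pos assms(3) by (simp add: divide_right_mono)
qed

end

text \<open>The quotient of the two sides is 1 + 2 * \<eta> / \<Lambda>, bounded only when \<eta> is
  at most a fixed multiple of \<Lambda>; hence \<open>K\<close>. The \<open>principal\<close> filter
  makes the O a uniform bound, with one constant for all triples in the set.\<close>

lemma deviation_bound_bigo:
  assumes "(0::real) < K"
  shows "(\<lambda>(\<Lambda>, \<eta>, L). (\<Lambda> + 2 * \<eta>) / (\<eta> * real L))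
    \<in> O[principal {(\<Lambda>, \<eta>, L). 0 < \<Lambda> \<and> 0 < \<eta> \<and> 1 \<le> L \<and> \<eta> \<le> K * \<Lambda>}](\<lambda>(\<Lambda>, \<eta>, L).
        \<Lambda> / (\<eta> * real L))"
\<comment> \<open>The constant comes from 2 * \<eta> \<le> 2 * K * \<Lambda>.\<close>
proof (rule landau_o.bigI[of "1 + 2 * K"])
  show "0 < 1 + 2 * K" using assms by simp
  have "(\<Lambda> + 2 * \<eta>) / (\<eta> * real L) \<le> (1 + 2 * K) * (\<Lambda> / (\<eta> * real L))"
    if "0 < \<eta>" "\<eta> \<le> K * \<Lambda>" for \<Lambda> \<eta> :: real and L :: nat
  proof -
    have "\<Lambda> + 2 * \<eta> \<le> (1 + 2 * K) * \<Lambda>" using that by (simp add: algebra_simps)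
    from divide_right_mono[OF this, of "\<eta> * real L"] show ?thesis using that by simp
  qed
  then show "\<forall>\<^sub>F x in principal {(\<Lambda>, \<eta>, L). 0 < \<Lambda> \<and> 0 < \<eta> \<and> 1 \<le> L \<and> \<eta> \<le> K * \<Lambda>}.
      norm (case x of (\<Lambda>, \<eta>, L) \<Rightarrow> (\<Lambda> + 2 * \<eta>) / (\<eta> * real L))
        \<le> (1 + 2 * K) * norm (case x of (\<Lambda>, \<eta>, L) \<Rightarrow> \<Lambda> / (\<eta> * real L))"
    by (auto simp: eventually_principal)
qed

theorem theorem1:
  fixes n T l L :: nat and Cmax \<phi> \<Lambda> \<eta> :: real and imin imax :: nat
    and r c :: "nat \<Rightarrow> nat \<Rightarrow> real" and play :: "nat \<Rightarrow> nat" and lam :: "nat \<Rightarrow> real"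
  assumes "primal_dual_aci n T Cmax \<phi> imin imax r c \<Lambda> \<eta> play lam"
    and "1 \<le> L" and "{l..l + L - 1} \<subseteq> {n - 1..T}"
  shows "\<bar>(1 / real L) * (\<Sum>t = l..l + L - 1. success r play t) - \<phi>\<bar>
           \<le> (\<Lambda> + 2 * \<eta>) / (\<eta> * real L)
         \<and> (\<forall>K>0. (\<lambda>(\<Lambda>', \<eta>', L'). (\<Lambda>' + 2 * \<eta>') / (\<eta>' * real L'))
             \<in> O[principal {(\<Lambda>', \<eta>', L'). 0 < \<Lambda>' \<and> 0 < \<eta>' \<and> 1 \<le> L' \<and> \<eta>' \<le> K * \<Lambda>'}](\<lambda>(\<Lambda>', \<eta>', L').
                 \<Lambda>' / (\<eta>' * real L')))"
proof -
  interpret primal_dual_aci n T Cmax \<phi> imin imax r c \<Lambda> \<eta> play lam by fact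
  \<comment> \<open>Since L \<ge> 1, the natural subtraction is not truncated and both endpoints
    belong to the interval, so the inclusion can be read off at them.\<close>
  have "l \<in> {l..l + L - 1}" "l + L - 1 \<in> {l..l + L - 1}"
    using assms(2) by auto
  then have "n - 1 \<le> l" "l + L \<le> Suc T" using assms(2,3) by force+
  moreover have "{l..l + L - 1} = {l..<l + L}" using assms(2) by auto
  ultimately show ?thesis
    using average_success_deviation[of l L] deviation_bound_bigo assms(2) by simp
qed

end
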